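(* Let $\mathcal H$ be a real Hilbert space, let $N\ge 2$, let $C_1,\dots,C_N$ be nonempty closed convex subsets of $\mathcal H$, let $x_0\in\mathcal H$, and let $(x_n^i)_{n\ge1}$, $i=1,\dots,N$, be the cyclic Douglas--Rachford sequences with initial point $x_0$. Then the following hold. (a) For each $i\in\{1,\dots,N\}$, as $n\to\infty$, $$P_{C_{i+1}}R_{C_i}x_n^i-P_{C_{i+1}}x_n^{i+1}=(x_n^{i+1}-x_n^i)-(P_{C_{i+1}}x_n^{i+1}-P_{C_i}x_n^i)\to 0 \quad\text{in norm}.$$ (b) Exactly one of the following alternatives holds. (i) $\operatorname{Fix} T_{[\sigma_i]}$ is empty for every $i\in\{1,\dots,N\}$. In this case $\|x_n^i\|\to+\infty$ as $n\to\infty$, for every $i$. (ii) $\operatorname{Fix} T_{[\sigma_i]}$ is nonempty for every $i\in\{1,\dots,N\}$. In this case there are points $x^i$, $i=1,\dots,N$ (with $x^{N+1}:=x^1$), such that for each $i\in\{1,\dots,N\}$, $(x_n^i)_{n\ge 1}$ converges weakly to $x^i\in\operatorname{Fix} T_{[\sigma_i]}$, and $x^{i+1}=T_{i,i+1}x^i$. Furthermore, for each $i\in\{1,\dots,N\}$, with $d^i$ the difference vectors of $C_1,\dots,C_N$, in norm as $n\to\infty$, $$x_n^{i+1}-x_n^i=P_{C_{i+1}}R_{C_i}x_n^i-P_{C_i}x_n^i\to d^i,\qquad P_{C_{i+1}}x_n^{i+1}-P_{C_i}x_n^i\to d^i,$$ and $$x^{i+1}-x^i=P_{C_{i+1}}x^{i+1}-P_{C_i}x^i=d^i,\qquad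 P_{C_{i+1}}R_{C_i}x^i=P_{C_{i+1}}x^{i+1}.$$
   Context: For a nonempty closed convex $C\subseteq\mathcal H$, $P_C$ is the nearest point projection onto $C$ and $R_C:=2P_C-I$ is the reflection. Indices of sets are cyclic: $C_0:=C_N$, $C_{N+1}:=C_1$. $\operatorname{Fix}T:=\{x\in\mathcal H: Tx=x\}$. Douglas--Rachford operators: $T_{i,i+1}:=T_{C_i,C_{i+1}}:=\frac12(I+R_{C_{i+1}}R_{C_i})$ for $i=1,\dots,N$ (so $T_{N,N+1}=T_{N,1}$). The cyclic Douglas--Rachford operator beginning with $C_i$ is the composition over one full cycle in which $T_{i,i+1}$ is applied first: $T_{[\sigma_i]}:=T_{i-1,i}\cdots T_{1,2}\,T_{N,1}\cdots T_{i+1,i+2}T_{i,i+1}$; e.g. $T_{[\sigma_1]}=T_{N,1}T_{N-1,N}\cdots T_{1,2}$. Cyclic Douglas--Rachford sequences with initial point $x_0$: $x_1^1:=x_0$, $x_n^{i+1}:=T_{i,i+1}x_n^i$ for $i=1,\dots,N$, $x_{n+1}^1:=x_n^{N+1}$. Thus $x_{n+1}^i=T_{[\sigma_i]}x_n^i$. Difference vectors: let $Q_i:=P_{C_i}P_{C_{i-1}}\cdots P_{C_1}P_{C_N}\cdots P_{C_{i+1}}$ for $i=1,\dots,N$. When the sets $\operatorname{Fix}Q_i$ are nonempty, pick $q^1\in\operatorname{Fix}Q_1$, set $q^{i+1}:=P_{C_{i+1}}q^i$ for $i=1,\dots,N$ (so $q^{N+1}=q^1$), and define $d^i:=q^{i+1}-q^i$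 for $i=1,\dots,N$. It is known (from the theory of cyclic projections) that $d^i$ does not depend on the choice of $q^1$. The assertions about $d^i$ in alternative (ii) are understood to include that the sets $\operatorname{Fix}Q_i$ are then nonempty, so that the $d^i$ are defined. *)

theory Defs
  imports "HOL-Analysis.Analysis"
begin

text \<open>
  Real Hilbert spaces are types of sort \<open>{real_inner, complete_space}\<close>. The library's
  \<open>closest_point\<close> lives in class \<open>heine_borel\<close>, that is, in finite dimension only, so the
  projection is defined here. For nonempty closed convex \<open>C\<close> in a Hilbert space the description
  below determines a unique point.
\<close>

definition nearest_point :: "'a::real_inner set \<Rightarrow> 'a \<Rightarrow> 'a" where
  "nearest_point C x = (THE p. p \<in> C \<and> (\<forall>y\<in>C. dist x p \<le> dist x y))"

definition reflection :: "'a::real_inner set \<Rightarrow> 'a \<Rightarrow> 'a" where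
  "reflection C x = 2 *\<^sub>R nearest_point C x - x"

definition Fix :: "('a \<Rightarrow> 'a) \<Rightarrow> 'a set" where
  "Fix T = {x. T x = x}"

definition DR_operator :: "'a::real_inner set \<Rightarrow> 'a set \<Rightarrow> 'a \<Rightarrow> 'a" where
  "DR_operator A B x = (1 / 2) *\<^sub>R (x + reflection B (reflection A x))"

text \<open>
  The family is \<open>C 1, \<dots>, C N\<close>; only these values of \<open>C\<close> are ever used. \<open>cyc N C i\<close> is the set with
  index \<open>i\<close> read cyclically, so \<open>cyc N C 0 = C N\<close> and \<open>cyc N C (N + 1) = C 1\<close>.
\<close>

definition cyc :: "nat \<Rightarrow> (nat \<Rightarrow> 'b) \<Rightarrow> nat \<Rightarrow> 'b" where
  "cyc N C i = C (if i mod N = 0 then N else i mod N)"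

definition DR_step :: "nat \<Rightarrow> (nat \<Rightarrow> 'a::real_inner set) \<Rightarrow> nat \<Rightarrow> 'a \<Rightarrow> 'a" where
  "DR_step N C i = DR_operator (cyc N C i) (cyc N C (i + 1))"

text \<open>
  \<open>fold\<close> applies the operator belonging to the head of the list first: \<open>cyclic_DR N C i\<close> applies
  the steps \<open>i, i + 1, \<dots>, i + N - 1\<close> in this order, and \<open>cyclic_proj N C i\<close> projects successively
  onto the sets with indices \<open>i + 1, \<dots>, i + N\<close>, all read modulo \<open>N\<close>.
\<close>

definition cyclic_DR :: "nat \<Rightarrow> (nat \<Rightarrow> 'a::real_inner set) \<Rightarrow> nat \<Rightarrow> 'a \<Rightarrow> 'a" where
  "cyclic_DR N C i = fold (DR_step N C) [i..<i + N]"

definition cyclic_proj :: "nat \<Rightarrow> (nat \<Rightarrow> 'a::real_inner set) \<Rightarrow> nat \<Rightarrow> 'a \<Rightarrow> 'a" where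
  "cyclic_proj N C i = fold (\<lambda>k. nearest_point (cyc N C k)) [i + 1..<i + N + 1]"

text \<open>\<open>x n i\<close> stands for \<open>x\<^sub>n\<^sup>i\<close> with \<open>n \<ge> 1\<close> and \<open>1 \<le> i \<le> N + 1\<close>; other values are irrelevant.\<close>

definition cyclic_DR_sequences ::
  "nat \<Rightarrow> (nat \<Rightarrow> 'a::real_inner set) \<Rightarrow> 'a \<Rightarrow> (nat \<Rightarrow> nat \<Rightarrow> 'a) \<Rightarrow> bool" where
  "cyclic_DR_sequences N C x0 x \<longleftrightarrow>
     x 1 1 = x0 \<and>
     (\<forall>n\<ge>1. (\<forall>i\<in>{1..N}. x n (i + 1) = DR_step N C i (x n i)) \<and> x (n + 1) 1 = x n (N + 1))"

text \<open>
  A predicate, because the vectors depend a priori on the choice of \<open>q 1\<close>, and because there are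
  none when \<open>cyclic_proj N C 1\<close> has no fixed point.
\<close>

definition difference_vectors ::
  "nat \<Rightarrow> (nat \<Rightarrow> 'a::real_inner set) \<Rightarrow> (nat \<Rightarrow> 'a) \<Rightarrow> bool" where
  "difference_vectors N C d \<longleftrightarrow>
     (\<exists>q. q 1 \<in> Fix (cyclic_proj N C 1) \<and>
          (\<forall>i\<in>{1..N}. q (i + 1) = nearest_point (cyc N C (i + 1)) (q i)) \<and>
          (\<forall>i\<in>{1..N}. d i = q (i + 1) - q i))"

text \<open>Continuous linear functionals on a Hilbert space are the maps \<open>\<lambda>u. u \<bullet> y\<close>.\<close>

definition weakly_converges :: "(nat \<Rightarrow> 'a::real_inner) \<Rightarrow> 'a \<Rightarrow> bool" where
  "weakly_converges u l \<longleftrightarrow> (\<forall>y. (\<lambda>n. u n \<bullet> y) \<longlonglongrightarrow> l \<bullet> y)"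

end

theory Submission
  imports Defs
begin

text \<open>
  Written as one sequence \<open>z\<close> with \<open>z (Suc k) = T k (z k)\<close>, the method is an orbit of a periodic family of
  firmly nonexpansive maps. Since \<open>z (Suc k) - P (Suc k) (R k (z k)) = z k - P k (z k)\<close>, the distance of
  \<open>z k\<close> to the \<open>k\<close>-th set is decreasing, and its squared decrements dominate the squared differences
  in (a). Comparing \<open>z\<close> with a periodic orbit \<open>p\<close>, firm nonexpansiveness makes the squared differences of
  their steps summable, so \<open>z\<close> takes asymptotically the same steps as \<open>p\<close>; Opial's argument gives
  the weak limits. Projecting a periodic orbit onto the sets yields a cycle of successive
  projections, whose steps are the difference vectors. Without a fixed point the norms diverge by the
  argument of Baillon, Bruck and Reich.
\<close>

subsection \<open>Asymptotic centers and nearest points\<close>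

text \<open>
  Asymptotic centers of filters replace weak compactness throughout: a constant family has the
  projection as its center, and the center of an asymptotically regular family is a fixed point.
\<close>

lemma asymptotic_center:
  fixes u :: "'b \<Rightarrow> 'a::{real_inner, complete_space}"
  assumes K: "K \<noteq> {}" "closed K" "convex K"
    and F: "F \<noteq> bot" and bdd: "\<forall>\<^sub>F n in F. norm (u n) \<le> B"
  obtains c R where "c \<in> K" "0 \<le> R"
    "\<forall>s>R. \<forall>\<^sub>F n in F. norm (u n - c) \<le> s"
    "\<forall>z\<in>K. \<forall>s. (\<forall>\<^sub>F n in F. norm (u n - z) \<le> s) \<longrightarrow> R \<le> s"
    "\<forall>z\<in>K. (\<forall>s>R. \<forall>\<^sub>F n in F. norm (u n - z) \<le> s) \<longrightarrow> z = c"
proof -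
  \<comment> \<open>\<open>near z s\<close> says that the ball of radius \<open>s\<close> about
    \<open>z\<close> eventually contains the family; \<open>R\<close>, the infimum of such radii
    over centers in \<open>K\<close>, is the asymptotic radius.\<close>
  define near where "near z s \<longleftrightarrow> (\<forall>\<^sub>F n in F. norm (u n - z) \<le> s)" for z s
  define G where "G = {s. \<exists>z\<in>K. near z s}"
  define R where "R = Inf G"
  have near_mono: "near z t" if "near z s" "s \<le> t" for z s t
    using that unfolding near_def by (auto elim!: eventually_mono)
  have near_nonneg: "0 \<le> s" if "near z s" for z s
  proof -
    from eventually_happens'[OF F that[unfolded near_def]] obtain n where "norm (u n - z) \<le> s" ..
    then show ?thesis
      using norm_ge_zero order_trans by blast
  qed
  have bdd_G: "bdd_below G"
    by (rule bdd_belowI[of _ 0]) (auto simp: G_def near_nonneg)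
  obtain k where "k \<in> K"
    using K by blast
  have "near k (B + norm k)"
    unfolding near_def using bdd
    by eventually_elim (rule order_trans[OF norm_triangle_ineq4], simp)
  then have G_ne: "G \<noteq> {}"
    using \<open>k \<in> K\<close> by (auto simp: G_def)
  have R_nonneg: "0 \<le> R"
    unfolding R_def using G_ne by (intro cInf_greatest) (auto simp: G_def near_nonneg)
  have R_le: "R \<le> s" if "z \<in> K" "near z s" for z s
    unfolding R_def using that by (intro cInf_lower bdd_G) (auto simp: G_def)
  \<comment> \<open>By the parallelogram law the midpoint of two centers with common radius
    \<open>r\<close>, which lies in \<open>K\<close> again, has radius
    \<open>sqrt (r^2 - |a - b|^2 / 4)\<close>, and this cannot fall below \<open>R\<close>.
    Near-optimal centers are therefore close together.\<close>
  have close: "(norm (a - b))\<^sup>2 \<le> 4 * (r\<^sup>2 - R\<^sup>2)"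
    if "a \<in> K" "b \<in> K" "near a r" "near b r" for a b r
  proof -
    define m where "m = (1/2) *\<^sub>R a + (1/2) *\<^sub>R b"
    define q where "q = r\<^sup>2 - (norm (a - b))\<^sup>2 / 4"
    have "m \<in> K"
      unfolding m_def using K(3) that(1,2) by (intro convexD) auto
    have para: "(norm (x - m))\<^sup>2 = ((norm (x - a))\<^sup>2 + (norm (x - b))\<^sup>2) / 2 - (norm (a - b))\<^sup>2 / 4" for x
      unfolding m_def
      by (simp add: power2_norm_eq_inner algebra_simps inner_commute add_divide_distrib diff_divide_distrib)
    have le: "\<forall>\<^sub>F n in F. (norm (u n - m))\<^sup>2 \<le> q"
      using that(3,4) unfolding near_def
    proof eventually_elim
      case (elim n)
      then have "(norm (u n - a))\<^sup>2 \<le> r\<^sup>2" "(norm (u n - b))\<^sup>2 \<le> r\<^sup>2"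
        by (auto intro!: power_mono)
      then show ?case
        unfolding para q_def by simp
    qed
    from eventually_happens'[OF F le] have "0 \<le> q"
      by (meson order_trans zero_le_power2)
    have "near m (sqrt q)"
      unfolding near_def using le by eventually_elim (rule real_le_rsqrt)
    then have "R \<le> sqrt q"
      using R_le \<open>m \<in> K\<close> by blast
    then have "R\<^sup>2 \<le> q"
      using R_nonneg \<open>0 \<le> q\<close> by (metis power_mono real_sqrt_pow2)
    then show ?thesis
      by (simp add: q_def)
  qed
  have unique: "a = b"
    if ab: "a \<in> K" "b \<in> K" "\<And>s. R < s \<Longrightarrow> near a s" "\<And>s. R < s \<Longrightarrow> near b s" for a b
  proof -
    have "(\<lambda>n. 4 * ((R + inverse (real (Suc n)))\<^sup>2 - R\<^sup>2)) \<longlonglongrightarrow> 4 * ((R + 0)\<^sup>2 - R\<^sup>2)"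
      by (intro tendsto_intros LIMSEQ_inverse_real_of_nat)
    moreover have "(norm (a - b))\<^sup>2 \<le> 4 * ((R + inverse (real (Suc n)))\<^sup>2 - R\<^sup>2)" for n
      by (intro close ab) auto
    ultimately have "(norm (a - b))\<^sup>2 \<le> 0"
      by (metis (no_types, lifting) LIMSEQ_le_const add.right_neutral diff_self mult_zero_right)
    then show ?thesis
      by simp
  qed
  \<comment> \<open>The sets \<open>D n\<close> are nested with diameters tending to 0, so Cantor's
    intersection theorem yields the center. Requiring all radii above \<open>\<rho> n\<close>, not
    \<open>\<rho> n\<close> itself, is what makes \<open>D n\<close> closed.\<close>
  define \<rho> where "\<rho> n = R + inverse (real (Suc n))" for n
  define D where "D n = {z \<in> K. \<forall>s>\<rho> n. near z s}" for n
  have \<rho>_gt: "R < \<rho> n" for n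
    by (simp add: \<rho>_def)
  have \<rho>_lim: "\<rho> \<longlonglongrightarrow> R"
    using tendsto_add[OF tendsto_const[of R] LIMSEQ_inverse_real_of_nat] by (simp add: \<rho>_def[abs_def])
  have D_closed: "closed (D n)" for n
    unfolding closed_sequential_limits
  proof safe
    fix f l assume f: "\<forall>k. f k \<in> D n" "f \<longlonglongrightarrow> l"
    have "l \<in> K"
      using closed_sequentially[OF K(2)] f by (auto simp: D_def)
    moreover have "near l s" if s: "\<rho> n < s" for s
    proof -
      define t where "t = (\<rho> n + s) / 2"
      have t: "\<rho> n < t" "0 < s - t"
        using s by (auto simp: t_def)
      obtain k where k: "dist (f k) l < s - t"
        using f(2) t(2) by (meson lim_sequentially order_refl)
      have "near (f k) t"
        using f(1) t by (auto simp: D_def)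
      then show ?thesis
        unfolding near_def
      proof eventually_elim
        case (elim m)
        have "norm (u m - l) \<le> norm (u m - f k) + norm (f k - l)"
          by (metis add_diff_add diff_add_cancel norm_triangle_ineq add_diff_eq)
        then show ?case
          using elim k by (simp add: dist_norm)
      qed
    qed
    ultimately show "l \<in> D n"
      by (simp add: D_def)
  qed
  have D_ne: "D n \<noteq> {}" for n
  proof -
    obtain s where "s \<in> G" "s < \<rho> n"
      using cInf_lessD[OF G_ne] \<rho>_gt unfolding R_def by metis
    then obtain z where "z \<in> K" "near z s"
      by (auto simp: G_def)
    then have "z \<in> D n"
      using \<open>s < \<rho> n\<close> near_mono by (fastforce simp: D_def)
    then show ?thesis
      by blast
  qed
  have D_mono: "D n \<subseteq> D m" if "m \<le> n" for m n
  proof -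
    have "\<rho> n \<le> \<rho> m"
      using that by (simp add: \<rho>_def)
    then show ?thesis
      by (auto simp: D_def)
  qed
  have D_small: "\<exists>n. \<forall>x\<in>D n. \<forall>y\<in>D n. dist x y < e" if "0 < e" for e
  proof -
    have "(\<lambda>n. 4 * ((\<rho> n + inverse (real (Suc n)))\<^sup>2 - R\<^sup>2)) \<longlonglongrightarrow> 4 * ((R + 0)\<^sup>2 - R\<^sup>2)"
      by (intro tendsto_intros LIMSEQ_inverse_real_of_nat \<rho>_lim)
    then have "\<forall>\<^sub>F n in sequentially. 4 * ((\<rho> n + inverse (real (Suc n)))\<^sup>2 - R\<^sup>2) < e\<^sup>2"
      using that by (intro order_tendstoD(2)) auto
    then obtain n where n: "4 * ((\<rho> n + inverse (real (Suc n)))\<^sup>2 - R\<^sup>2) < e\<^sup>2"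
      by (meson eventually_happens' sequentially_bot)
    have "dist x y < e" if "x \<in> D n" "y \<in> D n" for x y
    proof -
      have "(norm (x - y))\<^sup>2 \<le> 4 * ((\<rho> n + inverse (real (Suc n)))\<^sup>2 - R\<^sup>2)"
        using that by (intro close) (auto simp: D_def)
      then have "(norm (x - y))\<^sup>2 < e\<^sup>2"
        using n by simp
      then show ?thesis
        using \<open>0 < e\<close> by (simp add: dist_norm power_less_imp_less_base)
    qed
    then show ?thesis
      by blast
  qed
  obtain c where c: "\<And>n. c \<in> D n"
    using decreasing_closed_nest[of D] D_closed D_ne D_mono D_small by metis
  have "c \<in> K"
    using c by (auto simp: D_def)
  have near_c: "near c s" if s: "R < s" for s
  proof -
    obtain n where "\<rho> n < s"
      using order_tendstoD(2)[OF \<rho>_lim s] by (meson eventually_happens' sequentially_bot)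
    then show ?thesis
      using c[of n] by (auto simp: D_def)
  qed
  show thesis
    using \<open>c \<in> K\<close> R_nonneg near_c R_le unique by (intro that[of c R]) (auto simp: near_def)
qed

section \<open>Projections onto closed convex sets\<close>

lemma nearest_point_minimal:
  fixes C :: "'a::{real_inner, complete_space} set"
  assumes C: "C \<noteq> {}" "closed C" "convex C"
  shows "nearest_point C x \<in> C" (is ?A)
    and "y \<in> C \<Longrightarrow> dist x (nearest_point C x) \<le> dist x y" (is "_ \<Longrightarrow> ?B y")
proof -
  have ev: "eventually (\<lambda>_. P) sequentially \<longleftrightarrow> P" for P
    by simp
  \<comment> \<open>For the constant family \<open>x\<close>, \<open>R\<close> is the distance from
    \<open>x\<close> to \<open>C\<close>, attained at \<open>c\<close>; the uniqueness clause
    becomes uniqueness of the minimizer, which the definite description requires.\<close>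
  obtain c R where c: "c \<in> C" "0 \<le> R"
    "\<forall>s>R. norm (x - c) \<le> s"
    "\<forall>z\<in>C. \<forall>s. norm (x - z) \<le> s \<longrightarrow> R \<le> s"
    "\<forall>z\<in>C. (\<forall>s>R. norm (x - z) \<le> s) \<longrightarrow> z = c"
    by (rule asymptotic_center[OF C sequentially_bot, of "\<lambda>_. x" "norm x", unfolded ev, OF order_refl]) (rule that)
  have R: "norm (x - c) \<le> R"
    using c(3) dense_ge by blast
  have le: "norm (x - c) \<le> norm (x - y)" if "y \<in> C" for y
    using c(4) R that by force
  have "nearest_point C x = c"
    unfolding nearest_point_def
  proof (rule the_equality)
    show "c \<in> C \<and> (\<forall>y\<in>C. dist x c \<le> dist x y)"
      using c(1) le by (simp add: dist_norm)
  next
    fix p assume p: "p \<in> C \<and> (\<forall>y\<in>C. dist x p \<le> dist x y)"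
    then have "norm (x - p) \<le> norm (x - c)"
      using c(1) by (simp add: dist_norm)
    with R p show "p = c"
      by (intro c(5)[rule_format]) auto
  qed
  then show ?A "y \<in> C \<Longrightarrow> ?B y"
    using c(1) le by (simp_all add: dist_norm)
qed

lemma nearest_point_obtuse:
  fixes C :: "'a::{real_inner, complete_space} set"
  assumes C: "C \<noteq> {}" "closed C" "convex C" and "y \<in> C"
  shows "(x - nearest_point C x) \<bullet> (y - nearest_point C x) \<le> 0"
  using any_closest_point_dot[OF C(3,2) nearest_point_minimal(1)[OF C] \<open>y \<in> C\<close>]
    nearest_point_minimal(2)[OF C] by blast

text \<open>Converse of the variational inequality \<open>nearest_point_obtuse\<close>: adding that
  inequality at the projection to the hypothesis leaves the squared distance of the two points at
  most 0.\<close>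

lemma nearest_point_eqI:
  fixes C :: "'a::{real_inner, complete_space} set"
  assumes C: "C \<noteq> {}" "closed C" "convex C"
    and p: "p \<in> C" "\<And>y. y \<in> C \<Longrightarrow> (x - p) \<bullet> (y - p) \<le> 0"
  shows "nearest_point C x = p"
proof -
  let ?q = "nearest_point C x"
  have "(x - p) \<bullet> (?q - p) \<le> 0" "(x - ?q) \<bullet> (p - ?q) \<le> 0"
    using p nearest_point_minimal(1)[OF C] nearest_point_obtuse[OF C] by auto
  then have "(?q - p) \<bullet> (?q - p) \<le> 0"
    by (simp add: algebra_simps inner_commute)
  then have "(?q - p) \<bullet> (?q - p) = 0"
    by (meson antisym inner_ge_zero)
  then show ?thesis
    by simp
qed

text \<open>In a real inner product space this is equivalent to \<open>2 T - I\<close> being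
  nonexpansive. The form with two squares is convenient because the second one, the discrepancy of
  the displacements, is what gets summed along orbits.\<close>

definition firmly_nonexpansive :: "('a::real_inner \<Rightarrow> 'a) \<Rightarrow> bool" where
  "firmly_nonexpansive T \<longleftrightarrow>
     (\<forall>x y. (norm (T x - T y))\<^sup>2 + (norm ((T x - x) - (T y - y)))\<^sup>2 \<le> (norm (x - y))\<^sup>2)"

definition nonexpansive :: "('a::real_normed_vector \<Rightarrow> 'a) \<Rightarrow> bool" where
  "nonexpansive T \<longleftrightarrow> (\<forall>x y. norm (T x - T y) \<le> norm (x - y))"

lemma firmly_nonexpansive_imp_nonexpansive:
  assumes "firmly_nonexpansive T"
  shows "nonexpansive T"
  unfolding nonexpansive_def
proof (intro allI)
  fix x y
  have "(norm (T x - T y))\<^sup>2 \<le> (norm (x - y))\<^sup>2"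
    using assms unfolding firmly_nonexpansive_def by (smt (verit) zero_le_power2)
  then show "norm (T x - T y) \<le> norm (x - y)"
    by (rule power2_le_imp_le) simp
qed

text \<open>The variational inequalities at the two projections, each tested with the other
  projection, add up to the sign of the cross term.\<close>

lemma firmly_nonexpansive_nearest_point:
  fixes C :: "'a::{real_inner, complete_space} set"
  assumes C: "C \<noteq> {}" "closed C" "convex C"
  shows "firmly_nonexpansive (nearest_point C)"
  unfolding firmly_nonexpansive_def
proof (intro allI)
  fix x y
  let ?p = "nearest_point C x" and ?q = "nearest_point C y"
  have "(x - ?p) \<bullet> (?q - ?p) \<le> 0" "(y - ?q) \<bullet> (?p - ?q) \<le> 0"
    using nearest_point_minimal(1)[OF C] nearest_point_obtuse[OF C] by auto
  then show "(norm (?p - ?q))\<^sup>2 + (norm ((?p - x) - (?q - y)))\<^sup>2 \<le> (norm (x - y))\<^sup>2"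
    by (simp add: power2_norm_eq_inner algebra_simps inner_commute)
qed

text \<open>With \<open>u\<close> the difference of the projections and \<open>v = x - y\<close>,
  the parallelogram law gives \<open>|2 u - v|^2 = 2 |u|^2 + 2 |u - v|^2 - |v|^2\<close>, so firm
  nonexpansiveness of the projection is exactly what is needed.\<close>

lemma nonexpansive_reflection:
  fixes C :: "'a::{real_inner, complete_space} set"
  assumes "C \<noteq> {}" "closed C" "convex C"
  shows "nonexpansive (reflection C)"
  unfolding nonexpansive_def
proof (intro allI)
  fix x y
  have "(norm (reflection C x - reflection C y))\<^sup>2 \<le> (norm (x - y))\<^sup>2"
    using firmly_nonexpansive_nearest_point[OF assms, unfolded firmly_nonexpansive_def, rule_format, of x y]
    unfolding reflection_def by (simp add: power2_norm_eq_inner algebra_simps inner_commute)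
  then show "norm (reflection C x - reflection C y) \<le> norm (x - y)"
    by (rule power2_le_imp_le) simp
qed

text \<open>The operator is the average of the identity and a nonexpansive composition of two
  reflections; the parallelogram law turns the left-hand side into the mean of two squares.\<close>

lemma firmly_nonexpansive_DR_operator:
  fixes A B :: "'a::{real_inner, complete_space} set"
  assumes A: "A \<noteq> {}" "closed A" "convex A" and B: "B \<noteq> {}" "closed B" "convex B"
  shows "firmly_nonexpansive (DR_operator A B)"
  unfolding firmly_nonexpansive_def
proof (intro allI)
  fix x y
  define r s where "r = reflection B (reflection A x)" and "s = reflection B (reflection A y)"
  have "norm (r - s) \<le> norm (x - y)"
    unfolding r_def s_def
    using nonexpansive_reflection[OF A] nonexpansive_reflection[OF B] unfolding nonexpansive_def
    by (meson order_trans)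
  then have le: "(norm (r - s))\<^sup>2 \<le> (norm (x - y))\<^sup>2"
    by (rule power_mono) simp
  have T: "DR_operator A B x = (1/2) *\<^sub>R (x + r)" "DR_operator A B y = (1/2) *\<^sub>R (y + s)"
    by (simp_all add: DR_operator_def r_def s_def)
  have "(norm (DR_operator A B x - DR_operator A B y))\<^sup>2
      + (norm ((DR_operator A B x - x) - (DR_operator A B y - y)))\<^sup>2
      = ((norm (r - s))\<^sup>2 + (norm (x - y))\<^sup>2) / 2"
    unfolding T by (simp add: power2_norm_eq_inner algebra_simps inner_commute)
  also have "\<dots> \<le> ((norm (x - y))\<^sup>2 + (norm (x - y))\<^sup>2) / 2"
    by (intro divide_right_mono add_right_mono le) simp
  finally show "(norm (DR_operator A B x - DR_operator A B y))\<^sup>2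
      + (norm ((DR_operator A B x - x) - (DR_operator A B y - y)))\<^sup>2 \<le> (norm (x - y))\<^sup>2"
    by simp
qed

subsection \<open>Fixed points and weak convergence\<close>

text \<open>Since \<open>T\<close> is nonexpansive and nearly fixes the family, \<open>T c\<close>
  serves as a center just as well as \<open>c\<close>, and uniqueness of the center gives
  \<open>T c = c\<close>. Arbitrary filters make this available along subsequences as well.\<close>

lemma nonexpansive_fixed_point:
  fixes u :: "'b \<Rightarrow> 'a::{real_inner, complete_space}"
  assumes T: "nonexpansive T" and F: "F \<noteq> bot"
    and bdd: "\<forall>\<^sub>F n in F. norm (u n) \<le> B"
    and lim: "((\<lambda>n. T (u n) - u n) \<longlongrightarrow> 0) F"
  obtains c R where "c \<in> Fix T" "0 \<le> R"
    "\<forall>s>R. \<forall>\<^sub>F n in F. norm (u n - c) \<le> s"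
    "\<forall>z s. (\<forall>\<^sub>F n in F. norm (u n - z) \<le> s) \<longrightarrow> R \<le> s"
proof -
  obtain c R where c: "c \<in> (UNIV :: 'a set)" "0 \<le> R"
    "\<forall>s>R. \<forall>\<^sub>F n in F. norm (u n - c) \<le> s"
    "\<forall>z\<in>UNIV. \<forall>s. (\<forall>\<^sub>F n in F. norm (u n - z) \<le> s) \<longrightarrow> R \<le> s"
    "\<forall>z\<in>UNIV. (\<forall>s>R. \<forall>\<^sub>F n in F. norm (u n - z) \<le> s) \<longrightarrow> z = c"
    by (rule asymptotic_center[OF UNIV_not_empty closed_UNIV convex_UNIV F bdd]) (rule that)
  have "T c = c"
  proof (rule c(5)[rule_format])
    fix s assume "R < s"
    define e where "e = (s - R) / 2"
    have e: "0 < e" "R < s - e"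
      using \<open>R < s\<close> by (auto simp: e_def field_simps)
    have "\<forall>\<^sub>F n in F. norm (T (u n) - u n) < e"
      using tendstoD[OF lim \<open>0 < e\<close>] by simp
    with c(3)[rule_format, OF e(2)] show "\<forall>\<^sub>F n in F. norm (u n - T c) \<le> s"
    proof eventually_elim
      case (elim n)
      have "norm (u n - T c) \<le> norm (u n - T (u n)) + norm (T (u n) - T c)"
        using norm_triangle_ineq[of "u n - T (u n)" "T (u n) - T c"] by simp
      also have "norm (T (u n) - T c) \<le> norm (u n - c)"
        using T by (simp add: nonexpansive_def)
      finally show ?case
        using elim by (simp add: norm_minus_commute)
    qed
  qed simp
  then show thesis
    using that[of c R] c(2-4) by (auto simp: Fix_def)
qed

text \<open>The center \<open>p\<close> of the whole sequence is its weak limit: if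
  \<open>(u n - p) \<bullet> y\<close> were at least \<open>\<epsilon>\<close> infinitely often,
  moving the center in direction \<open>y\<close> would lower the asymptotic radius along those
  indices. Monotonicity of the distances to fixed points forbids this.\<close>

lemma opial_weak_convergence:
  fixes u :: "nat \<Rightarrow> 'a::{real_inner, complete_space}"
  assumes T: "nonexpansive T" and ne: "Fix T \<noteq> {}"
    and step: "\<And>n. u (Suc n) = T (u n)"
    and reg: "(\<lambda>n. u (Suc n) - u n) \<longlonglongrightarrow> 0"
  obtains p where "p \<in> Fix T" "weakly_converges u p"
proof -
  have anti: "norm (u n - z) \<le> norm (u m - z)" if "z \<in> Fix T" "m \<le> n" for z m n
    using \<open>m \<le> n\<close>
  proof (induction rule: dec_induct)
    case (step n)
    have "norm (u (Suc n) - z) = norm (T (u n) - T z)"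
      using that by (simp add: assms(3) Fix_def)
    also have "\<dots> \<le> norm (u n - z)"
      using T by (simp add: nonexpansive_def)
    finally show ?case
      using step by simp
  qed simp
  obtain z0 where z0: "z0 \<in> Fix T"
    using ne by blast
  define B where "B = norm (u 0 - z0) + norm z0"
  have bdd: "norm (u n) \<le> B" for n
    using anti[OF z0, of 0 n] norm_triangle_ineq[of "u n - z0" z0] by (simp add: B_def)
  have reg': "((\<lambda>n. T (u n) - u n) \<longlongrightarrow> 0) F" if "F \<le> sequentially" for F
    using tendsto_mono[OF that reg] by (simp add: step)
  obtain p R where p: "p \<in> Fix T" "0 \<le> R"
    "\<forall>s>R. \<forall>\<^sub>F n in sequentially. norm (u n - p) \<le> s"
    "\<forall>z s. (\<forall>\<^sub>F n in sequentially. norm (u n - z) \<le> s) \<longrightarrow> R \<le> s"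
    by (rule nonexpansive_fixed_point[OF T sequentially_bot _ reg'[OF order_refl], of B]) (use bdd in \<open>auto intro: that\<close>)
  have not_far: "\<forall>\<^sub>F n in sequentially. (u n - p) \<bullet> y < \<epsilon>" if "0 < \<epsilon>" for y \<epsilon>
  proof (rule ccontr)
    assume "\<not> ?thesis"
    then have freq: "\<exists>\<^sub>F n in sequentially. \<epsilon> \<le> (u n - p) \<bullet> y"
      by (simp add: frequently_def not_le)
    define F where "F = inf sequentially (principal {n. \<epsilon> \<le> (u n - p) \<bullet> y})"
    have F: "F \<noteq> bot" "F \<le> sequentially"
      using freq by (auto simp: F_def trivial_limit_def eventually_inf_principal frequently_def)
    have ev_F: "\<forall>\<^sub>F n in F. \<epsilon> \<le> (u n - p) \<bullet> y"
      by (simp add: F_def eventually_inf_principal)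
    obtain p' R' where p': "p' \<in> Fix T" "0 \<le> R'"
      "\<forall>s>R'. \<forall>\<^sub>F n in F. norm (u n - p') \<le> s"
      "\<forall>z s. (\<forall>\<^sub>F n in F. norm (u n - z) \<le> s) \<longrightarrow> R' \<le> s"
      by (rule nonexpansive_fixed_point[OF T F(1) _ reg'[OF F(2)], of B]) (use bdd in \<open>auto intro: that\<close>)
    \<comment> \<open>Fejer monotonicity: a bound on the distance to the fixed point
      \<open>p'\<close> at one index \<open>m\<close> holds from \<open>m\<close> on, so restricting
      to a subsequence cannot lower the radius.\<close>
    have "R \<le> R'"
    proof (rule dense_ge)
      fix s assume "R' < s"
      then obtain m where m: "norm (u m - p') \<le> s"
        using eventually_happens'[OF F(1) p'(3)[rule_format]] by blast
      show "R \<le> s"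
        using anti[OF p'(1), of m] m
        by (intro p(4)[rule_format, of p']) (auto simp: eventually_sequentially intro: order_trans)
    qed
    \<comment> \<open>The shift by \<open>t y\<close> changes the squared distance by
      \<open>t^2 |y|^2 - 2 t (u n - p) \<bullet> y\<close>, which is at most \<open>- \<eta>\<close>
      by the choice of \<open>t\<close>; half of \<open>\<eta>\<close> pays for the distance to
      \<open>p\<close> exceeding \<open>R\<close>. The \<open>+ 1\<close> covers
      \<open>y = 0\<close>.\<close>
    define t \<eta> where "t = \<epsilon> / ((norm y)\<^sup>2 + 1)" and "\<eta> = t * \<epsilon>"
    have ny: "0 < (norm y)\<^sup>2 + 1"
      by (rule add_nonneg_pos) auto
    have t: "0 < t" "t * (norm y)\<^sup>2 \<le> \<epsilon>"
      using that ny by (auto simp: t_def field_simps)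
    have \<eta>: "0 < \<eta>"
      using t that by (simp add: \<eta>_def)
    have R2: "R < sqrt (R\<^sup>2 + \<eta> / 2)"
      using \<eta> by (intro real_less_rsqrt) simp
    have "\<forall>\<^sub>F n in F. norm (u n - p) \<le> sqrt (R\<^sup>2 + \<eta> / 2)"
      using p(3)[rule_format, OF R2] F(2) by (rule filter_leD[rotated])
    then have "\<forall>\<^sub>F n in F. norm (u n - (p + t *\<^sub>R y)) \<le> sqrt (R\<^sup>2 - \<eta> / 2)"
      using ev_F
    proof eventually_elim
      case (elim n)
      have "(norm (u n - p))\<^sup>2 \<le> (sqrt (R\<^sup>2 + \<eta> / 2))\<^sup>2"
        using elim(1) by (intro power_mono) auto
      then have 1: "(norm (u n - p))\<^sup>2 \<le> R\<^sup>2 + \<eta> / 2"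
        using \<eta> by simp
      have 2: "t * \<epsilon> \<le> t * ((u n - p) \<bullet> y)"
        using elim(2) t(1) by simp
      have 3: "t * (t * (norm y)\<^sup>2) \<le> t * \<epsilon>"
        using t by (intro mult_left_mono) auto
      have "(norm (u n - (p + t *\<^sub>R y)))\<^sup>2
          = (norm (u n - p))\<^sup>2 - 2 * (t * ((u n - p) \<bullet> y)) + t * (t * (norm y)\<^sup>2)"
        by (simp add: power2_norm_eq_inner algebra_simps inner_commute)
      also have "\<dots> \<le> R\<^sup>2 - \<eta> / 2"
        using 1 2 3 by (simp add: \<eta>_def)
      finally show ?case
        by (rule real_le_rsqrt)
    qed
    then have "R' \<le> sqrt (R\<^sup>2 - \<eta> / 2)"
      by (rule p'(4)[rule_format])
    also have "\<dots> < sqrt (R\<^sup>2)"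
      using \<eta> by (intro real_sqrt_less_mono) simp
    finally show False
      using \<open>R \<le> R'\<close> p(2) by simp
  qed
  have "(\<lambda>n. u n \<bullet> y) \<longlonglongrightarrow> p \<bullet> y" for y
  proof (rule tendstoI)
    fix e :: real assume "0 < e"
    from not_far[OF this, of y] not_far[OF this, of "- y"]
    show "\<forall>\<^sub>F n in sequentially. dist (u n \<bullet> y) (p \<bullet> y) < e"
      by eventually_elim (auto simp: dist_real_def abs_less_iff inner_diff_left)
  qed
  with p(1) show thesis
    by (intro that) (auto simp: weakly_converges_def)
qed

subsection \<open>Periodic families of firmly nonexpansive maps\<close>

text \<open>A decreasing sequence bounded below converges, so its decrements vanish.\<close>

lemma tendsto_zero_if_square_le_decrement:
  fixes f :: "nat \<Rightarrow> 'a::real_normed_vector" and g :: "nat \<Rightarrow> real"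
  assumes le: "\<And>n. (norm (f n))\<^sup>2 \<le> g n - g (Suc n)" and nonneg: "\<And>n. 0 \<le> g n"
  shows "f \<longlonglongrightarrow> 0"
proof -
  have "decseq g"
    using le by (intro decseq_SucI) (smt (verit) zero_le_power2)
  then obtain L where "g \<longlonglongrightarrow> L"
    using decseq_convergent[of g 0] nonneg by blast
  then have "(\<lambda>n. g n - g (Suc n)) \<longlonglongrightarrow> L - L"
    by (intro tendsto_diff LIMSEQ_Suc)
  then have lim: "(\<lambda>n. g n - g (Suc n)) \<longlonglongrightarrow> 0"
    by simp
  have "(\<lambda>n. (norm (f n))\<^sup>2) \<longlonglongrightarrow> 0"
    by (rule tendsto_sandwich[OF _ _ tendsto_const lim]) (simp_all add: le)
  then have "(\<lambda>n. sqrt ((norm (f n))\<^sup>2)) \<longlonglongrightarrow> sqrt 0"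
    by (rule tendsto_real_sqrt)
  then show ?thesis
    by (simp add: tendsto_norm_zero_iff)
qed

definition orbit :: "(nat \<Rightarrow> 'a \<Rightarrow> 'a) \<Rightarrow> (nat \<Rightarrow> 'a) \<Rightarrow> bool" where
  "orbit S z \<longleftrightarrow> (\<forall>k. z (Suc k) = S k (z k))"

lemma orbit_add: "orbit S z \<Longrightarrow> z (k + m) = fold S [k..<k + m] (z k)"
  by (induction m) (auto simp: orbit_def)

lemma nonexpansive_fold:
  "(\<And>k. k \<in> set ks \<Longrightarrow> nonexpansive (S k)) \<Longrightarrow> nonexpansive (fold S ks)"
proof (induction ks)
  case (Cons k ks)
  show ?case
    unfolding nonexpansive_def
  proof (intro allI)
    fix x y
    have "norm (fold S ks (S k x) - fold S ks (S k y)) \<le> norm (S k x - S k y)"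
      using Cons by (simp add: nonexpansive_def)
    also have "\<dots> \<le> norm (x - y)"
      using Cons.prems[of k] by (simp add: nonexpansive_def)
    finally show "norm (fold S (k # ks) x - fold S (k # ks) y) \<le> norm (x - y)"
      by simp
  qed
qed (simp add: nonexpansive_def)

text \<open>Indexing the maps by all naturals with period \<open>N\<close> turns the method into a
  single orbit, without reduction of indices.\<close>

locale cyclic_firmly_nonexpansive =
  fixes N :: nat and S :: "nat \<Rightarrow> 'a::{real_inner, complete_space} \<Rightarrow> 'a"
  assumes N_pos: "0 < N"
    and firm: "\<And>k. firmly_nonexpansive (S k)"
    and S_add_N: "\<And>k. S (k + N) = S k"
begin

abbreviation cycle :: "nat \<Rightarrow> 'a \<Rightarrow> 'a" where
  "cycle k \<equiv> fold S [k..<k + N]"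

text \<open>One object in place of fixed points of all the cyclic compositions: its value at
  \<open>k\<close> is fixed by \<open>cycle k\<close>, and every fixed point of
  \<open>cycle k\<close> arises in this way.\<close>

definition periodic_orbit :: "(nat \<Rightarrow> 'a) \<Rightarrow> bool" where
  "periodic_orbit p \<longleftrightarrow> orbit S p \<and> (\<forall>k. p (k + N) = p k)"

lemma S_add_mult_N: "S (k + n * N) = S k"
proof (induction n)
  case (Suc n)
  then show ?case
    using S_add_N[of "k + n * N"] by (simp add: add_ac)
qed simp

lemma periodic_orbit_add_mult: "periodic_orbit p \<Longrightarrow> p (k + n * N) = p k"
proof (induction n)
  case (Suc n)
  then show ?case
    unfolding periodic_orbit_def by (metis add.assoc add.commute mult_Suc)
qed simp

lemma orbit_shift: "orbit S z \<Longrightarrow> orbit S (\<lambda>k. z (k + N))"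
  using S_add_N by (auto simp: orbit_def)

lemma fold_shift: "fold S [k + n * N..<k + n * N + m] = fold S [k..<k + m]"
proof -
  have "S (k + n * N + m) = S (k + m)" for m
    using S_add_mult_N[of "k + m" n] by (simp add: add_ac)
  then show ?thesis
    by (induction m) simp_all
qed

lemma cycle_add_mult: "cycle (k + n * N) = cycle k"
  by (rule fold_shift)

lemma orbit_cycle: "orbit S z \<Longrightarrow> z (k + n * N) = (cycle k ^^ n) (z k)"
proof (induction n)
  case (Suc n)
  have "z (k + Suc n * N) = z (k + n * N + N)"
    by (simp add: add_ac)
  also have "\<dots> = cycle (k + n * N) (z (k + n * N))"
    using Suc.prems by (rule orbit_add)
  finally show ?case
    using Suc by (simp add: cycle_add_mult)
qed simp

lemma periodic_orbit_Fix: "periodic_orbit p \<Longrightarrow> p k \<in> Fix (cycle k)"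
  using orbit_add[of S p k N] by (simp add: periodic_orbit_def Fix_def)

lemma Fix_periodic_orbit:
  assumes "u \<in> Fix (cycle k)"
  obtains p where "periodic_orbit p" "p k = u"
proof -
  \<comment> \<open>Indices \<open>j < k\<close> must be reached too, so \<open>u\<close> is run
    from time \<open>k\<close> to time \<open>j + k * N\<close>; this is not before \<open>k\<close>
    because \<open>N > 0\<close>, and has the same phase as \<open>j\<close>.\<close>
  define p where "p j = fold S [k..<j + k * N] u" for j
  have k_le: "k \<le> j + k * N" for j
    using N_pos by (simp add: trans_le_add2)
  have orbit: "orbit S p"
    using k_le by (auto simp: orbit_def p_def S_add_mult_N)
  have cycle_u: "cycle k u = u"
    using assms by (simp add: Fix_def)
  have "fold S [k..<k + n * N] u = u" for n
  proof (induction n)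
    case (Suc n)
    have "[k..<k + Suc n * N] = [k..<k + n * N] @ [k + n * N..<k + n * N + N]"
      using upt_add_eq_append[of k "k + n * N" N] by (simp add: add_ac)
    then show ?case
      using Suc cycle_u by (simp add: cycle_add_mult)
  qed simp
  then have pk: "p k = u"
    by (simp add: p_def)
  have "p (j + N) = p j" for j
  proof -
    define m where "m = j + k * N - k"
    have m: "j + k * N = k + m" "j + N + k * N = k + N + m"
      using k_le[of j] by (auto simp: m_def)
    have "fold S [k..<k + N + m] u = fold S [k..<k + m] u"
      using upt_add_eq_append[of k "k + N" m] fold_shift[of k 1 m] cycle_u by simp
    then show ?thesis
      by (simp add: p_def m)
  qed
  then show thesis
    using that[of p] orbit pk by (simp add: periodic_orbit_def)
qed

lemma firm_ineq:
  "(norm (S k x - S k y))\<^sup>2 + (norm ((S k x - x) - (S k y - y)))\<^sup>2 \<le> (norm (x - y))\<^sup>2"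
  using firm[of k] by (simp add: firmly_nonexpansive_def)

lemma nonexpansive_cycle: "nonexpansive (cycle k)"
  by (intro nonexpansive_fold firmly_nonexpansive_imp_nonexpansive firm)

lemma orbit_difference_square:
  assumes "orbit S z" "orbit S y"
  shows "(norm (z (Suc k) - y (Suc k)))\<^sup>2 + (norm ((z (Suc k) - z k) - (y (Suc k) - y k)))\<^sup>2
    \<le> (norm (z k - y k))\<^sup>2"
  using firm_ineq[of k "z k" "y k"] assms by (simp add: orbit_def)

text \<open>Each squared discrepancy of steps is bounded by the decrement of the squared distance
  between the orbits. The comparison is made with a periodic orbit, and with the orbit itself
  shifted by one period.\<close>

lemma orbit_steps_asymptotic:
  assumes "orbit S z" "orbit S y"
  shows "(\<lambda>k. (z (Suc k) - z k) - (y (Suc k) - y k)) \<longlonglongrightarrow> 0"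
  by (rule tendsto_zero_if_square_le_decrement[where g = "\<lambda>k. (norm (z k - y k))\<^sup>2"])
    (use orbit_difference_square[OF assms] in \<open>auto simp: le_diff_eq add.commute\<close>)

lemma orbit_increments_asymptotic:
  assumes "orbit S z" "orbit S y"
  shows "(\<lambda>k. (z (k + m) - z k) - (y (k + m) - y k)) \<longlonglongrightarrow> 0"
proof (induction m)
  case (Suc m)
  have "(\<lambda>k. (z (Suc (k + m)) - z (k + m)) - (y (Suc (k + m)) - y (k + m))) \<longlonglongrightarrow> 0"
    using LIMSEQ_ignore_initial_segment[OF orbit_steps_asymptotic[OF assms], of m] by simp
  from tendsto_add[OF Suc this] show ?case
    by (simp add: algebra_simps)
qed simp

lemma subseq_add_mult_N: "strict_mono (\<lambda>n. k + n * N)"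
  using N_pos by (auto intro!: strict_monoI)

text \<open>Increments over a period tend to 0 because those of \<open>p0\<close> vanish, so Opial's
  argument gives a weak limit at phase 0, which extends to a periodic orbit \<open>p\<close>. The
  other phases follow since the steps of \<open>z\<close> approach those of \<open>p\<close> in
  norm.\<close>

lemma weak_limit_periodic_orbit:
  assumes z: "orbit S z" and p0: "periodic_orbit p0"
  obtains p where "periodic_orbit p" "\<And>k. weakly_converges (\<lambda>n. z (k + n * N)) (p k)"
proof -
  have reg: "(\<lambda>k. z (k + N) - z k) \<longlonglongrightarrow> 0"
    using orbit_increments_asymptotic[OF z, of p0 N] p0 by (simp add: periodic_orbit_def)
  have reg_N: "(\<lambda>n. z (0 + Suc n * N) - z (0 + n * N)) \<longlonglongrightarrow> 0"
    using LIMSEQ_subseq_LIMSEQ[OF reg subseq_add_mult_N[of 0]] by (simp add: o_def add.commute)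
  have step: "z (0 + Suc n * N) = cycle 0 (z (0 + n * N))" for n
    using orbit_cycle[OF z, of 0 "Suc n"] orbit_cycle[OF z, of 0 n] by simp
  have ne: "Fix (cycle 0) \<noteq> {}"
    using periodic_orbit_Fix[OF p0] by blast
  obtain u where u: "u \<in> Fix (cycle 0)" "weakly_converges (\<lambda>n. z (0 + n * N)) u"
    by (rule opial_weak_convergence[OF nonexpansive_cycle ne step reg_N])
  obtain p where p: "periodic_orbit p" "p 0 = u"
    using Fix_periodic_orbit[OF u(1)] by blast
  have "weakly_converges (\<lambda>n. z (k + n * N)) (p k)" for k
  proof (induction k)
    case 0
    then show ?case
      using u(2) p(2) by simp
  next
    case (Suc k)
    have orb: "orbit S p"
      using p(1) by (simp add: periodic_orbit_def)
    have "(\<lambda>n. (z (Suc (k + n * N)) - z (k + n * N)) - (p (Suc (k + n * N)) - p (k + n * N))) \<longlonglongrightarrow> 0"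
      using LIMSEQ_subseq_LIMSEQ[OF orbit_steps_asymptotic[OF z orb] subseq_add_mult_N[of k]]
      by (simp add: o_def)
    then have lim: "(\<lambda>n. (z (Suc k + n * N) - z (k + n * N)) - (p (Suc k) - p k)) \<longlonglongrightarrow> 0"
      using periodic_orbit_add_mult[OF p(1), of k] periodic_orbit_add_mult[OF p(1), of "Suc k"] by simp
    show ?case
      unfolding weakly_converges_def
    proof
      fix y
      have "(\<lambda>n. ((z (Suc k + n * N) - z (k + n * N)) - (p (Suc k) - p k)) \<bullet> y) \<longlonglongrightarrow> 0 \<bullet> y"
        by (intro tendsto_inner lim tendsto_const)
      moreover have "(\<lambda>n. z (k + n * N) \<bullet> y) \<longlonglongrightarrow> p k \<bullet> y"
        using Suc by (simp add: weakly_converges_def)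
      ultimately have "(\<lambda>n. ((z (Suc k + n * N) - z (k + n * N)) - (p (Suc k) - p k)) \<bullet> y
          + z (k + n * N) \<bullet> y + (p (Suc k) - p k) \<bullet> y) \<longlonglongrightarrow> 0 \<bullet> y + p k \<bullet> y + (p (Suc k) - p k) \<bullet> y"
        by (intro tendsto_add tendsto_const)
      then show "(\<lambda>n. z (Suc k + n * N) \<bullet> y) \<longlonglongrightarrow> p (Suc k) \<bullet> y"
        by (simp add: inner_diff_left)
    qed
  qed
  then show thesis
    using that p(1) by blast
qed

text \<open>
  The increments \<open>z (l + N) - z l\<close> decrease in norm to some \<open>L\<close>, and their differences tend to \<open>0\<close>, so
  \<open>z (j + m * N)\<close> moves at least \<open>m * L\<close> away from \<open>z j\<close>. If \<open>L = 0\<close>, a bounded subsequence would have an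
  asymptotic center, which is a fixed point.
\<close>

lemma orbit_norm_at_top:
  assumes z: "orbit S z" and no: "\<And>p. \<not> periodic_orbit p"
  shows "filterlim (\<lambda>n. norm (z (k + n * N))) at_top sequentially"
proof -
  have zm: "orbit S (\<lambda>k. z (k + m * N))" for m
    using z S_add_mult_N by (simp add: orbit_def)
  have dist_dec: "norm (z (l + m * N) - z l) \<le> norm (z (j + m * N) - z j)" if "j \<le> l" for j l m
    using that
  proof (induction rule: dec_induct)
    case (step l)
    have "(norm (z (Suc l + m * N) - z (Suc l)))\<^sup>2 \<le> (norm (z (l + m * N) - z l))\<^sup>2"
      using orbit_difference_square[OF zm[of m] z, of l] by (smt (verit) zero_le_power2)
    then have "norm (z (Suc l + m * N) - z (Suc l)) \<le> norm (z (l + m * N) - z l)"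
      by (rule power2_le_imp_le) simp
    with step show ?case
      by simp
  qed simp
  define w where "w l = z (l + N) - z l" for l
  have "decseq (\<lambda>l. norm (w l))"
    using dist_dec[of _ _ 1] by (simp add: w_def decseq_def)
  then obtain L where L: "(\<lambda>l. norm (w l)) \<longlonglongrightarrow> L"
    using decseq_convergent[of "\<lambda>l. norm (w l)" 0] by auto
  have "0 \<le> L"
    using L by (rule LIMSEQ_le_const) simp
  have lower: "m * L \<le> norm (z (j + m * N) - z j)" for j m
  proof -
    have w_shift: "(\<lambda>l. w (l + r) - w l) \<longlonglongrightarrow> 0" for r
      using orbit_increments_asymptotic[OF orbit_shift[OF z] z, of r]
      by (simp add: w_def algebra_simps)
    \<comment> \<open>\<open>z (l + m * N) - z l\<close> is the sum of the \<open>m\<close>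
      increments \<open>w (l + i * N)\<close>, \<open>i < m\<close>, each asymptotically equal to
      \<open>w l\<close>. Its norm thus approaches \<open>m * L\<close>, and since it decreases in
      \<open>l\<close> it is at least \<open>m * L\<close> at \<open>j\<close>.\<close>
    have "(\<lambda>l. z (l + m * N) - z l - real m *\<^sub>R w l) \<longlonglongrightarrow> 0"
    proof (induction m)
      case (Suc m)
      from tendsto_add[OF Suc w_shift[of "m * N"]] show ?case
        by (simp add: w_def algebra_simps)
    qed simp
    then have "(\<lambda>l. norm (z (l + m * N) - z l - real m *\<^sub>R w l) + norm (z (j + m * N) - z j)) \<longlonglongrightarrow> 0 + norm (z (j + m * N) - z j)"
      by (intro tendsto_add tendsto_const tendsto_norm_zero)
    moreover have "(\<lambda>l. real m * norm (w l)) \<longlonglongrightarrow> real m * L"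
      by (intro tendsto_mult tendsto_const L)
    moreover have "real m * norm (w l) \<le> norm (z (l + m * N) - z l - real m *\<^sub>R w l) + norm (z (j + m * N) - z j)"
      if "j \<le> l" for l
    proof -
      have "real m * norm (w l) = norm (real m *\<^sub>R w l)"
        by simp
      also have "\<dots> \<le> norm (z (l + m * N) - z l - real m *\<^sub>R w l) + norm (z (l + m * N) - z l)"
        using norm_triangle_sub[of "real m *\<^sub>R w l" "z (l + m * N) - z l"] by (simp add: norm_minus_commute)
      finally show ?thesis
        using dist_dec[OF that, of m] by simp
    qed
    ultimately show ?thesis
      by (intro LIMSEQ_le[of "\<lambda>l. real m * norm (w l)"]) auto
  qed
  show ?thesis
  proof (cases "L = 0")
    case False
    then have "0 < L"
      using \<open>0 \<le> L\<close> by simp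
    have "filterlim (\<lambda>n. - norm (z k) + real n * L) at_top sequentially"
      using \<open>0 < L\<close>
      by (intro filterlim_tendsto_add_at_top[OF tendsto_const]
          filterlim_at_top_mult_tendsto_pos[OF tendsto_const] filterlim_real_sequentially)
    then show ?thesis
    proof (rule filterlim_at_top_mono, intro always_eventually allI)
      fix n
      show "- norm (z k) + real n * L \<le> norm (z (k + n * N))"
        using lower[of n k] norm_triangle_ineq4[of "z (k + n * N)" "z k"] by simp
    qed
  next
    case True
    then have w0: "w \<longlonglongrightarrow> 0"
      using L by (simp add: tendsto_norm_zero_iff)
    show ?thesis
    proof (rule ccontr)
      assume "\<not> ?thesis"
      then obtain B where "\<not> (\<forall>\<^sub>F n in sequentially. B < norm (z (k + n * N)))"
        by (auto simp: filterlim_at_top_dense)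
      then have freq: "\<exists>\<^sub>F n in sequentially. norm (z (k + n * N)) \<le> B"
        by (simp add: frequently_def not_le)
      define F where "F = inf sequentially (principal {n. norm (z (k + n * N)) \<le> B})"
      have F: "F \<noteq> bot" "F \<le> sequentially"
        using freq by (auto simp: F_def trivial_limit_def eventually_inf_principal frequently_def)
      have bdd: "\<forall>\<^sub>F n in F. norm (z (k + n * N)) \<le> B"
        by (simp add: F_def eventually_inf_principal)
      have "cycle k (z (k + n * N)) - z (k + n * N) = w (k + n * N)" for n
        using orbit_add[OF z, of "k + n * N" N] by (simp add: w_def cycle_add_mult)
      moreover have "(\<lambda>n. w (k + n * N)) \<longlonglongrightarrow> 0"
        using LIMSEQ_subseq_LIMSEQ[OF w0 subseq_add_mult_N[of k]] by (simp add: o_def)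
      ultimately have "((\<lambda>n. cycle k (z (k + n * N)) - z (k + n * N)) \<longlongrightarrow> 0) F"
        using F(2) by (simp add: tendsto_mono)
      from nonexpansive_fixed_point[OF nonexpansive_cycle F(1) bdd this]
      obtain c where "c \<in> Fix (cycle k)"
        by metis
      then show False
        using Fix_periodic_orbit no by metis
    qed
  qed
qed

end

subsection \<open>Cyclic Douglas--Rachford orbits\<close>

lemma DR_operator_minus:
  "DR_operator A B x - x = nearest_point B (reflection A x) - nearest_point A x"
proof -
  define a b where "a = nearest_point A x" and "b = nearest_point B (reflection A x)"
  have "DR_operator A B x - x = (1/2) *\<^sub>R (x + (2 *\<^sub>R b - (2 *\<^sub>R a - x))) - x"
    unfolding DR_operator_def reflection_def[of B] b_def[symmetric]
    by (simp add: reflection_def a_def)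
  also have "\<dots> = (1/2) *\<^sub>R (2 *\<^sub>R (b - a + x)) - x"
    by (simp only: scaleR_2 algebra_simps)
  also have "\<dots> = b - a"
    by simp
  finally show ?thesis
    by (simp add: a_def b_def)
qed

text \<open>The angle at the projection is not acute, so the cross term in the expansion has the
  right sign.\<close>

lemma nearest_point_pythagoras:
  fixes C :: "'a::{real_inner, complete_space} set"
  assumes "C \<noteq> {}" "closed C" "convex C" "y \<in> C"
  shows "(norm (x - nearest_point C x))\<^sup>2 + (norm (y - nearest_point C x))\<^sup>2 \<le> (norm (x - y))\<^sup>2"
  using nearest_point_obtuse[OF assms, of x]
  by (simp add: power2_norm_eq_inner algebra_simps inner_commute)

text \<open>Around a closed chain the decrements of the squared distances telescope to 0, and they
  dominate the squared discrepancies of the steps. This is why difference vectors do not depend on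
  the chosen cycle.\<close>

lemma closed_chain_steps_unique:
  fixes a q :: "nat \<Rightarrow> 'a::real_inner"
  assumes T: "\<And>k. k < N \<Longrightarrow> firmly_nonexpansive (T k)"
    and a: "\<And>k. k < N \<Longrightarrow> a (Suc k) = T k (a k)" "a N = a 0"
    and q: "\<And>k. k < N \<Longrightarrow> q (Suc k) = T k (q k)" "q N = q 0"
    and "k < N"
  shows "a (Suc k) - a k = q (Suc k) - q k"
proof -
  let ?e = "\<lambda>k. (norm ((a (Suc k) - a k) - (q (Suc k) - q k)))\<^sup>2"
  have "(\<Sum>k<N. ?e k) \<le> (\<Sum>k<N. (norm (a k - q k))\<^sup>2 - (norm (a (Suc k) - q (Suc k)))\<^sup>2)"
  proof (rule sum_mono)
    fix k assume "k \<in> {..<N}"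
    then have k: "k < N"
      by simp
    have "(norm (T k (a k) - T k (q k)))\<^sup>2 + (norm ((T k (a k) - a k) - (T k (q k) - q k)))\<^sup>2
        \<le> (norm (a k - q k))\<^sup>2"
      using T[OF k] unfolding firmly_nonexpansive_def by blast
    then show "?e k \<le> (norm (a k - q k))\<^sup>2 - (norm (a (Suc k) - q (Suc k)))\<^sup>2"
      unfolding a(1)[OF k] q(1)[OF k] by linarith
  qed
  also have "\<dots> = 0"
    using sum_lessThan_telescope'[of "\<lambda>k. (norm (a k - q k))\<^sup>2" N] a(2) q(2) by simp
  finally have "(\<Sum>k<N. ?e k) = 0"
    by (intro antisym sum_nonneg) auto
  then have "?e k = 0"
    using \<open>k < N\<close> by (subst (asm) sum_nonneg_eq_0_iff) auto
  then show ?thesis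
    by simp
qed

locale cyclic_sets =
  fixes N :: nat and A :: "nat \<Rightarrow> 'a::{real_inner, complete_space} set"
  assumes N_pos: "0 < N"
    and sets: "\<And>k. A k \<noteq> {}" "\<And>k. closed (A k)" "\<And>k. convex (A k)"
    and A_add_N: "\<And>k. A (k + N) = A k"
begin

sublocale cyclic_firmly_nonexpansive N "\<lambda>k. DR_operator (A k) (A (Suc k))"
proof
  show "DR_operator (A (k + N)) (A (Suc (k + N))) = DR_operator (A k) (A (Suc k))" for k
    using A_add_N[of k] A_add_N[of "Suc k"] by simp
qed (simp_all add: N_pos firmly_nonexpansive_DR_operator sets)

abbreviation P :: "nat \<Rightarrow> 'a \<Rightarrow> 'a" where
  "P k \<equiv> nearest_point (A k)"

abbreviation R :: "nat \<Rightarrow> 'a \<Rightarrow> 'a" where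
  "R k \<equiv> reflection (A k)"

abbreviation DR_orbit :: "(nat \<Rightarrow> 'a) \<Rightarrow> bool" where
  "DR_orbit \<equiv> orbit (\<lambda>k. DR_operator (A k) (A (Suc k)))"

lemma DR_orbit_step: "DR_orbit z \<Longrightarrow> z (Suc k) - z k = P (Suc k) (R k (z k)) - P k (z k)"
  by (simp add: orbit_def DR_operator_minus)

lemma projections_asymptotic:
  assumes "DR_orbit z"
  shows "(\<lambda>k. P (Suc k) (R k (z k)) - P (Suc k) (z (Suc k))) \<longlonglongrightarrow> 0"
proof (rule tendsto_zero_if_square_le_decrement[where g = "\<lambda>k. (norm (z k - P k (z k)))\<^sup>2"])
  fix k
  \<comment> \<open>The point \<open>P (Suc k) (R k (z k))\<close> of \<open>A (Suc k)\<close> is as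
    far from \<open>z (Suc k)\<close> as \<open>P k (z k)\<close> is from \<open>z k\<close>; used
    as test point in the Pythagorean inequality, it yields the decrement.\<close>
  have "z (Suc k) - P (Suc k) (R k (z k)) = z k - P k (z k)"
    using DR_orbit_step[OF assms, of k] by (simp add: algebra_simps)
  then show "(norm (P (Suc k) (R k (z k)) - P (Suc k) (z (Suc k))))\<^sup>2
      \<le> (norm (z k - P k (z k)))\<^sup>2 - (norm (z (Suc k) - P (Suc k) (z (Suc k))))\<^sup>2"
    using nearest_point_pythagoras[OF sets nearest_point_minimal(1)[OF sets], of "z (Suc k)" "Suc k" "R k (z k)"]
    by simp
qed simp

text \<open>The difference of the two sides is periodic in \<open>k\<close> and tends to 0, hence
  vanishes.\<close>

lemma periodic_orbit_projection:
  assumes p: "periodic_orbit p"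
  shows "P (Suc k) (R k (p k)) = P (Suc k) (p (Suc k))"
proof -
  define f where "f k = P (Suc k) (R k (p k)) - P (Suc k) (p (Suc k))" for k
  have "f (k + N) = f k" for k
    using p A_add_N[of k] A_add_N[of "Suc k"] unfolding f_def periodic_orbit_def
    by (metis add_Suc)
  then have f_period: "f (k + n * N) = f k" for n
    by (induction n) (simp_all, metis add.assoc add.commute)
  have "f \<longlonglongrightarrow> 0"
    using projections_asymptotic[of p] p by (simp add: f_def[abs_def] periodic_orbit_def)
  then have "(\<lambda>n. f (k + n * N)) \<longlonglongrightarrow> 0"
    using LIMSEQ_subseq_LIMSEQ[OF _ subseq_add_mult_N[of k]] by (force simp: o_def)
  then have "f k = 0"
    by (simp add: f_period LIMSEQ_const_iff)
  then show ?thesis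
    by (simp add: f_def)
qed

lemma periodic_orbit_step:
  "periodic_orbit p \<Longrightarrow> p (Suc k) - p k = P (Suc k) (p (Suc k)) - P k (p k)"
  using DR_orbit_step[of p k] periodic_orbit_projection[of p k] by (simp add: periodic_orbit_def)

text \<open>
  The vector \<open>p k - P k (p k)\<close> does not depend on \<open>k\<close> and is normal to every set; adding it to the
  normal that characterizes the projection of the reflected point leaves \<open>P k (p k)\<close> projecting
  onto the next set.
\<close>

lemma periodic_orbit_projection_chain:
  assumes p: "periodic_orbit p"
  shows "P (Suc k) (P k (p k)) = P (Suc k) (p (Suc k))"
proof (rule nearest_point_eqI[OF sets nearest_point_minimal(1)[OF sets]])
  fix y assume y: "y \<in> A (Suc k)"
  let ?b = "P (Suc k) (p (Suc k))"
  have "(R k (p k) - ?b) \<bullet> (y - ?b) \<le> 0" "(p (Suc k) - ?b) \<bullet> (y - ?b) \<le> 0"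
    using nearest_point_obtuse[OF sets y, of "R k (p k)"] nearest_point_obtuse[OF sets y, of "p (Suc k)"]
      periodic_orbit_projection[OF p, of k] by simp_all
  then have "((R k (p k) - ?b) + (p (Suc k) - ?b)) \<bullet> (y - ?b) \<le> 0"
    by (simp only: inner_add_left)
  \<comment> \<open>With \<open>a = P k (p k)\<close>, the sum equals
    \<open>2 (a - ?b) + (p (Suc k) - p k)\<close>, and the step is \<open>?b - a\<close>.\<close>
  moreover have "(R k (p k) - ?b) + (p (Suc k) - ?b) = P k (p k) - ?b"
    using periodic_orbit_step[OF p, of k] by (simp add: reflection_def scaleR_2 algebra_simps)
  ultimately show "(P k (p k) - ?b) \<bullet> (y - ?b) \<le> 0"
    by simp
qed

text \<open>The points \<open>P k (p k)\<close> form a closed chain of successive projections whose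
  steps are those of \<open>p\<close>. Any other closed chain \<open>q\<close> has the same steps,
  which identifies the difference vectors.\<close>

lemma projection_chain_steps:
  assumes p: "periodic_orbit p"
    and q: "\<And>k. k < N \<Longrightarrow> q (Suc k) = P (Suc k) (q k)" "q N = q 0"
    and "k < N"
  shows "q (Suc k) - q k = p (Suc k) - p k"
proof -
  have "P N (p N) = P 0 (p 0)"
    using p A_add_N[of 0] by (simp add: periodic_orbit_def) (metis add_0)
  then have "P (Suc k) (p (Suc k)) - P k (p k) = q (Suc k) - q k"
    using periodic_orbit_projection_chain[OF p] q \<open>k < N\<close>
    by (intro closed_chain_steps_unique[of N "\<lambda>k. P (Suc k)"]) (simp_all add: firmly_nonexpansive_nearest_point sets)
  then show ?thesis
    using periodic_orbit_step[OF p] by simp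
qed

text \<open>Supplies the fixed points of the cyclic projections in alternative (ii). The shift
  \<open>Suc k\<close> occurs because a point of \<open>A k\<close> is projected onto
  \<open>A (Suc k)\<close> next.\<close>

lemma periodic_orbit_Fix_projections:
  assumes p: "periodic_orbit p"
  shows "P k (p k) \<in> Fix (fold (\<lambda>k. P (Suc k)) [k..<k + N])"
proof -
  have "orbit (\<lambda>k. P (Suc k)) (\<lambda>k. P k (p k))"
    using periodic_orbit_projection_chain[OF p] by (simp add: orbit_def)
  from orbit_add[OF this, of k N] show ?thesis
    using p A_add_N[of k] by (simp add: periodic_orbit_def Fix_def)
qed

end

section \<open>Translation to the indices of the statement\<close>

theorem theorem2p8:
  fixes C :: "nat \<Rightarrow> 'a::{real_inner, complete_space} set"
    and N :: nat
    and x0 :: 'a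
    and x :: "nat \<Rightarrow> nat \<Rightarrow> 'a"
  assumes "N \<ge> 2"
    and "\<And>i. i \<in> {1..N} \<Longrightarrow> C i \<noteq> {} \<and> closed (C i) \<and> convex (C i)"
    and "cyclic_DR_sequences N C x0 x"
  shows
    "(\<forall>i\<in>{1..N}.
        (\<forall>n\<ge>1.
           nearest_point (cyc N C (i + 1)) (reflection (cyc N C i) (x n i))
             - nearest_point (cyc N C (i + 1)) (x n (i + 1))
           = (x n (i + 1) - x n i)
             - (nearest_point (cyc N C (i + 1)) (x n (i + 1)) - nearest_point (cyc N C i) (x n i))) \<and>
        (\<lambda>n. nearest_point (cyc N C (i + 1)) (reflection (cyc N C i) (x n i))
             - nearest_point (cyc N C (i + 1)) (x n (i + 1))) \<longlonglongrightarrow> 0)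
     \<and>
     ((\<forall>i\<in>{1..N}. Fix (cyclic_DR N C i) = {}) \<noteq> (\<forall>i\<in>{1..N}. Fix (cyclic_DR N C i) \<noteq> {}))
     \<and>
     ((\<forall>i\<in>{1..N}. Fix (cyclic_DR N C i) = {}) \<longrightarrow>
        (\<forall>i\<in>{1..N}. filterlim (\<lambda>n. norm (x n i)) at_top sequentially))
     \<and>
     ((\<forall>i\<in>{1..N}. Fix (cyclic_DR N C i) \<noteq> {}) \<longrightarrow>
        (\<exists>xx. xx (N + 1) = xx 1 \<and>
           (\<forall>i\<in>{1..N}. weakly_converges (\<lambda>n. x n i) (xx i) \<and>
              xx i \<in> Fix (cyclic_DR N C i) \<and> xx (i + 1) = DR_step N C i (xx i)) \<and>
           (\<forall>i\<in>{1..N}. Fix (cyclic_proj N C i) \<noteq> {}) \<and>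
           (\<forall>d. difference_vectors N C d \<longrightarrow>
              (\<forall>i\<in>{1..N}.
                 (\<forall>n\<ge>1. x n (i + 1) - x n i
                    = nearest_point (cyc N C (i + 1)) (reflection (cyc N C i) (x n i))
                      - nearest_point (cyc N C i) (x n i)) \<and>
                 (\<lambda>n. x n (i + 1) - x n i) \<longlonglongrightarrow> d i \<and>
                 (\<lambda>n. nearest_point (cyc N C (i + 1)) (x n (i + 1))
                      - nearest_point (cyc N C i) (x n i)) \<longlonglongrightarrow> d i \<and>
                 xx (i + 1) - xx i
                   = nearest_point (cyc N C (i + 1)) (xx (i + 1)) - nearest_point (cyc N C i) (xx i) \<and>
                 nearest_point (cyc N C (i + 1)) (xx (i + 1)) - nearest_point (cyc N C i) (xx i) = d i \<and>
                 nearest_point (cyc N C (i + 1)) (reflection (cyc N C i) (xx i))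
                   = nearest_point (cyc N C (i + 1)) (xx (i + 1))))))"
    (is "?a \<and> ?excl \<and> (?none \<longrightarrow> ?div) \<and> (?all \<longrightarrow> ?conv)")
proof -
  \<comment> \<open>\<open>A\<close> starts at 0: \<open>A 0\<close> is \<open>C 1\<close> and
    \<open>A (N - 1)\<close> is \<open>C N\<close>. Index \<open>i\<close> of the statement becomes
    \<open>j = i - 1\<close>.\<close>
  define A where "A k = cyc N C (Suc k)" for k
  have cyc_A: "cyc N C (Suc k) = A k" for k
    by (simp add: A_def)
  have A_props: "A k \<noteq> {} \<and> closed (A k) \<and> convex (A k)" for k
    unfolding A_def cyc_def using assms(1) by (intro assms(2)) (auto simp: Suc_le_eq)
  interpret cyclic_sets N A
  proof
    show "A (k + N) = A k" for k
      unfolding A_def cyc_def using mod_add_self2[of "Suc k" N] by simp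
  qed (use assms(1) A_props in auto)
  have DR_step: "DR_step N C (Suc k) = DR_operator (A k) (A (Suc k))" for k
    by (simp add: DR_step_def A_def)
  have cyclic_DR: "cyclic_DR N C (Suc k) = cycle k" for k
    unfolding cyclic_DR_def add_Suc map_Suc_upt[symmetric] fold_map
    by (simp add: o_def DR_step)
  have cyclic_proj: "cyclic_proj N C (Suc k) = fold (\<lambda>k. P (Suc k)) [k..<k + N]" for k
  proof -
    have "[Suc k + 1..<Suc k + N + 1] = map Suc (map Suc [k..<k + N])"
      by (simp add: map_Suc_upt)
    then show ?thesis
      by (simp add: cyclic_proj_def fold_map o_def cyc_A)
  qed
  define z where "z k = fold (\<lambda>k. DR_operator (A k) (A (Suc k))) [0..<k] x0" for k
  have z: "DR_orbit z"
    by (simp add: orbit_def z_def)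
  have x_init: "x 1 1 = x0"
    and x_step: "\<And>n i. 1 \<le> n \<Longrightarrow> i \<in> {1..N} \<Longrightarrow> x n (i + 1) = DR_step N C i (x n i)"
    and x_next: "\<And>n. 1 \<le> n \<Longrightarrow> x (n + 1) 1 = x n (N + 1)"
    using assms(3) by (auto simp: cyclic_DR_sequences_def)
  \<comment> \<open>The case \<open>j = N\<close> is included: the last entry of a row is the first
    one of the next, which drives the induction in \<open>x_start\<close>. In total,
    \<open>x n i\<close> is \<open>z\<close> at time \<open>i - 1 + (n - 1) * N\<close>.\<close>
  have x_row: "x (Suc m) (Suc j) = z (j + m * N)"
    if "x (Suc m) (Suc 0) = z (m * N)" "j \<le> N" for m j
    using that(2)
  proof (induction j)
    case (Suc j)
    then have "x (Suc m) (Suc (Suc j)) = DR_operator (A j) (A (Suc j)) (z (j + m * N))"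
      using x_step[of "Suc m" "Suc j"] by (simp add: DR_step)
    also have "\<dots> = z (Suc (j + m * N))"
      using z S_add_mult_N[of j m] by (simp add: orbit_def)
    finally show ?case
      by simp
  qed (use that in simp)
  have x_start: "x (Suc m) (Suc 0) = z (m * N)" for m
  proof (induction m)
    case 0
    then show ?case
      using x_init by (simp add: z_def)
  next
    case (Suc m)
    then show ?case
      using x_next[of "Suc m"] x_row[OF Suc order_refl] by simp
  qed
  have x_eq: "x (Suc m) (Suc j) = z (j + m * N)" if "j \<le> N" for m j
    by (rule x_row[OF x_start that])
  \<comment> \<open>The values \<open>x 0 i\<close> are unconstrained, so limits are computed along
    \<open>Suc n\<close>.\<close>
  have lim_Suc: "X \<longlonglongrightarrow> l" if "(\<lambda>n. X (Suc n)) \<longlonglongrightarrow> l" for X :: "nat \<Rightarrow> 'a" and l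
    using that by (rule LIMSEQ_imp_Suc)
  have A_shift: "A (j + m * N) = A j" for j m
    by (induction m) (simp_all, metis A_add_N add.assoc add.commute)
  have A_shift': "A (Suc (j + m * N)) = A (Suc j)" for j m
    using A_shift[of "Suc j" m] by simp
  have all_iff: "(\<forall>i\<in>{1..N}. Q i) \<longleftrightarrow> (\<forall>j<N. Q (Suc j))" for Q
    by (auto simp: Suc_le_eq) (metis Suc_le_eq Suc_pred less_Suc_eq_le)
  have ge1_iff: "(\<forall>n\<ge>1. Q n) \<longleftrightarrow> (\<forall>m. Q (Suc m))" for Q :: "nat \<Rightarrow> bool"
    by (metis One_nat_def Suc_le_D Suc_le_mono le0)
  have step: "x (Suc m) (Suc (Suc j)) - x (Suc m) (Suc j)
      = P (Suc j) (R j (x (Suc m) (Suc j))) - P j (x (Suc m) (Suc j))" if "j < N" for m j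
    using that DR_orbit_step[OF z, of "j + m * N"] x_eq[of j m] x_eq[of "Suc j" m]
    by (simp add: A_shift A_shift')
  have proj_lim: "(\<lambda>n. P (Suc j) (R j (x n (Suc j))) - P (Suc j) (x n (Suc (Suc j)))) \<longlonglongrightarrow> 0" if "j < N" for j
  proof (rule lim_Suc)
    have "(\<lambda>n. P (Suc (j + n * N)) (R (j + n * N) (z (j + n * N)))
        - P (Suc (j + n * N)) (z (Suc (j + n * N)))) \<longlonglongrightarrow> 0"
      using LIMSEQ_subseq_LIMSEQ[OF projections_asymptotic[OF z] subseq_add_mult_N[of j]]
      by (simp add: o_def)
    then show "(\<lambda>n. P (Suc j) (R j (x (Suc n) (Suc j))) - P (Suc j) (x (Suc n) (Suc (Suc j)))) \<longlonglongrightarrow> 0"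
      using that by (simp add: x_eq A_shift A_shift')
  qed
  have ?a
    unfolding all_iff ge1_iff
  proof (intro allI impI conjI)
    fix j m assume "j < N"
    then show "nearest_point (cyc N C (Suc j + 1)) (reflection (cyc N C (Suc j)) (x (Suc m) (Suc j)))
             - nearest_point (cyc N C (Suc j + 1)) (x (Suc m) (Suc j + 1))
           = (x (Suc m) (Suc j + 1) - x (Suc m) (Suc j))
             - (nearest_point (cyc N C (Suc j + 1)) (x (Suc m) (Suc j + 1))
                - nearest_point (cyc N C (Suc j)) (x (Suc m) (Suc j)))"
      using step[of j m] by (simp add: cyc_A)
  qed (use proj_lim in \<open>simp add: cyc_A\<close>)
  \<comment> \<open>A fixed point of one cycle yields a periodic orbit and thus fixed points of all
    cycles; as the index range is nonempty, exactly one alternative holds.\<close>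
  have all_Fix: "Fix (cycle k) \<noteq> {}" if "Fix (cycle j) \<noteq> {}" for j k
    using that Fix_periodic_orbit periodic_orbit_Fix by (metis ex_in_conv)
  have ?excl
    unfolding all_iff cyclic_DR using all_Fix N_pos by blast
  have "?div" if ?none
    unfolding all_iff
  proof (intro allI impI)
    fix j assume "j < N"
    have "\<not> periodic_orbit p" for p
      using that periodic_orbit_Fix[of p 0] N_pos unfolding all_iff cyclic_DR by blast
    from orbit_norm_at_top[OF z this, of j]
    have "filterlim (\<lambda>n. norm (x (Suc n) (Suc j))) at_top sequentially"
      using \<open>j < N\<close> by (simp add: x_eq)
    then show "filterlim (\<lambda>n. norm (x n (Suc j))) at_top sequentially"
      by (rule filterlim_sequentially_Suc[THEN iffD1])
  qed
  moreover have ?conv if all: ?all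
  proof -
    obtain u where "u \<in> Fix (cycle 0)"
      using all N_pos unfolding all_iff cyclic_DR by blast
    then obtain p0 where "periodic_orbit p0"
      using Fix_periodic_orbit by blast
    then obtain p where p: "periodic_orbit p" and weak: "\<And>k. weakly_converges (\<lambda>n. z (k + n * N)) (p k)"
      using weak_limit_periodic_orbit[OF z] by blast
    have p_orbit: "DR_orbit p" and p_N: "p N = p 0"
      using p unfolding periodic_orbit_def by (auto dest: spec[of _ 0])
    have x_weak: "weakly_converges (\<lambda>n. x n (Suc j)) (p j)" if "j < N" for j
      unfolding weakly_converges_def
    proof
      fix y
      have "(\<lambda>n. x (Suc n) (Suc j) \<bullet> y) \<longlonglongrightarrow> p j \<bullet> y"
        using weak[of j] that by (simp add: weakly_converges_def x_eq)
      then show "(\<lambda>n. x n (Suc j) \<bullet> y) \<longlonglongrightarrow> p j \<bullet> y"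
        by (rule LIMSEQ_imp_Suc)
    qed
    have x_diff: "(\<lambda>n. x n (Suc (Suc j)) - x n (Suc j)) \<longlonglongrightarrow> p (Suc j) - p j" if "j < N" for j
    proof (rule lim_Suc)
      have "(\<lambda>n. (z (Suc (j + n * N)) - z (j + n * N)) - (p (Suc (j + n * N)) - p (j + n * N))) \<longlonglongrightarrow> 0"
        using LIMSEQ_subseq_LIMSEQ[OF orbit_steps_asymptotic[OF z p_orbit] subseq_add_mult_N[of j]]
        by (simp add: o_def)
      then have "(\<lambda>n. (x (Suc n) (Suc (Suc j)) - x (Suc n) (Suc j)) - (p (Suc j) - p j)) \<longlonglongrightarrow> 0"
        using that periodic_orbit_add_mult[OF p, of j] periodic_orbit_add_mult[OF p, of "Suc j"]
        by (simp add: x_eq)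
      then show "(\<lambda>n. x (Suc n) (Suc (Suc j)) - x (Suc n) (Suc j)) \<longlonglongrightarrow> p (Suc j) - p j"
        by (simp only: LIM_zero_iff)
    qed
    have P_diff: "(\<lambda>n. P (Suc j) (x n (Suc (Suc j))) - P j (x n (Suc j))) \<longlonglongrightarrow> p (Suc j) - p j" if "j < N" for j
    proof (rule lim_Suc)
      \<comment> \<open>The step of the projections is the step of the sequence minus the vanishing
        difference in (a).\<close>
      from tendsto_diff[OF x_diff[OF that] proj_lim[OF that], THEN LIMSEQ_Suc]
      show "(\<lambda>n. P (Suc j) (x (Suc n) (Suc (Suc j))) - P j (x (Suc n) (Suc j))) \<longlonglongrightarrow> p (Suc j) - p j"
        by (simp add: step[OF that])
    qed
    \<comment> \<open>For any admissible \<open>q\<close>, the fixed point property of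
      \<open>q 1\<close> closes the chain, so its steps are those of \<open>p\<close>.\<close>
    have d_eq: "d (Suc j) = p (Suc j) - p j" if d: "difference_vectors N C d" and j: "j < N" for d j
    proof -
      obtain q where q: "q 1 \<in> Fix (cyclic_proj N C 1)"
        "\<forall>i\<in>{1..N}. q (i + 1) = nearest_point (cyc N C (i + 1)) (q i)"
        "\<forall>i\<in>{1..N}. d i = q (i + 1) - q i"
        using d by (auto simp: difference_vectors_def)
      have q_step: "q (Suc (Suc k)) = P (Suc k) (q (Suc k))" if "k < N" for k
        using q(2) that unfolding all_iff by (simp add: cyc_A)
      have "q (Suc m) = fold (\<lambda>k. P (Suc k)) [0..<m] (q 1)" if "m \<le> N" for m
        using that by (induction m) (simp_all add: q_step)
      from this[of N] have "q (Suc N) = q (Suc 0)"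
        using q(1) cyclic_proj[of 0] by (simp add: Fix_def)
      then have "q (Suc (Suc j)) - q (Suc j) = p (Suc j) - p j"
        using projection_chain_steps[OF p, of "\<lambda>k. q (Suc k)"] q_step j by simp
      then show ?thesis
        using q(3) j unfolding all_iff by simp
    qed
    have Fix_proj: "Fix (cyclic_proj N C (Suc j)) \<noteq> {}" for j
      using periodic_orbit_Fix_projections[OF p, of j] unfolding cyclic_proj by blast
    show ?thesis
      unfolding all_iff ge1_iff
    \<comment> \<open>The weak limits are \<open>p\<close> with the index shifted back by one;
      \<open>p N = p 0\<close> gives the required equality at \<open>N + 1\<close>.\<close>
    proof (intro exI[of _ "\<lambda>i. p (i - 1)"] conjI allI impI)
      fix j d assume j: "j < N"
      show "weakly_converges (\<lambda>n. x n (Suc j)) (p (Suc j - 1))"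
        using x_weak[OF j] by simp
      show "p (Suc j - 1) \<in> Fix (cyclic_DR N C (Suc j))"
        using periodic_orbit_Fix[OF p] by (simp add: cyclic_DR)
      show "p (Suc j + 1 - 1) = DR_step N C (Suc j) (p (Suc j - 1))"
        using p_orbit by (simp add: orbit_def DR_step)
      show "nearest_point (cyc N C (Suc j + 1)) (reflection (cyc N C (Suc j)) (p (Suc j - 1)))
          = nearest_point (cyc N C (Suc j + 1)) (p (Suc j + 1 - 1))"
        using periodic_orbit_projection[OF p, of j] by (simp add: cyc_A)
      show p_step: "p (Suc j + 1 - 1) - p (Suc j - 1)
          = nearest_point (cyc N C (Suc j + 1)) (p (Suc j + 1 - 1)) - nearest_point (cyc N C (Suc j)) (p (Suc j - 1))"
        using periodic_orbit_step[OF p, of j] by (simp add: cyc_A)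
      show "x (Suc m) (Suc j + 1) - x (Suc m) (Suc j)
          = nearest_point (cyc N C (Suc j + 1)) (reflection (cyc N C (Suc j)) (x (Suc m) (Suc j)))
            - nearest_point (cyc N C (Suc j)) (x (Suc m) (Suc j))" for m
        using step[OF j, of m] by (simp add: cyc_A)
      assume d: "difference_vectors N C d"
      show "(\<lambda>n. x n (Suc j + 1) - x n (Suc j)) \<longlonglongrightarrow> d (Suc j)"
        using x_diff[OF j] d_eq[OF d j] by simp
      show "(\<lambda>n. nearest_point (cyc N C (Suc j + 1)) (x n (Suc j + 1))
          - nearest_point (cyc N C (Suc j)) (x n (Suc j))) \<longlonglongrightarrow> d (Suc j)"
        using P_diff[OF j] d_eq[OF d j] by (simp add: cyc_A)
      show "nearest_point (cyc N C (Suc j + 1)) (p (Suc j + 1 - 1))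
          - nearest_point (cyc N C (Suc j)) (p (Suc j - 1)) = d (Suc j)"
        using p_step d_eq[OF d j] by simp
    qed (simp_all add: p_N Fix_proj)
  qed
  ultimately show ?thesis
    using \<open>?a\<close> \<open>?excl\<close> by blast
qed

end
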